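(* There exist constants $c>0$ and $L_0>0$ such that for every $L\ge L_0$ there exists a $2L$-periodic function $\phi\in H^2_{\rm per}([-L,L])$ (so that $\phi_x$ is $2L$-periodic with zero mean) such that $$\int_{-L}^{L}\left(u_{xx}^2-u_x^2+\phi_x u^2\right)dx\ \ge\ \frac14\int_{-L}^{L}\left(u_{xx}^2+u^2\right)dx$$ for all real-valued $u\in C^2[-L,L]$ with $u(0)=0$, and moreover $$\|\phi\|_{H^2}\le c\,L^{3/2}.$$
   Context: $H^2_{\rm per}([-L,L])$ is the space of $2L$-periodic functions with two weak derivatives in $L_2([-L,L])$, and $\|\phi\|_{H^2}$ is the $H^2$ norm on $[-L,L]$. The only boundary condition imposed on $u$ is the single Dirichlet condition $u(0)=0$ at the origin. *)

theory Defs
  imports "HOL-Analysis.Analysis" "HOL-Library.Periodic_Fun"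
begin

definition test_function :: "(real \<Rightarrow> real) \<Rightarrow> bool" where
  "test_function \<psi> \<longleftrightarrow>
     (\<forall>n. (deriv ^^ n) \<psi> differentiable_on UNIV) \<and> compact (closure {x. \<psi> x \<noteq> 0})"

definition locally_integrable :: "(real \<Rightarrow> real) \<Rightarrow> bool" where
  "locally_integrable f \<longleftrightarrow> (\<forall>a b. set_integrable lebesgue {a..b} f)"

(* Weak differentiation on the whole line. A relation, since the weak derivative
   is determined only up to a null set. *)
definition has_weak_derivative :: "(real \<Rightarrow> real) \<Rightarrow> (real \<Rightarrow> real) \<Rightarrow> bool"
    (infix "has'_weak'_derivative" 50) where
  "f has_weak_derivative g \<longleftrightarrow>
     locally_integrable f \<and> locally_integrable g \<and>
     (\<forall>\<psi>. test_function \<psi> \<longrightarrow>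
        (LINT x|lebesgue. f x * deriv \<psi> x) = - (LINT x|lebesgue. g x * \<psi> x))"

definition square_integrable_on :: "(real \<Rightarrow> real) \<Rightarrow> real set \<Rightarrow> bool"
    (infix "square'_integrable'_on" 50) where
  "f square_integrable_on S \<longleftrightarrow>
     set_borel_measurable lebesgue S f \<and> set_integrable lebesgue S (\<lambda>x. (f x)\<^sup>2)"

(* "H2_per L f f' f''" reads: f belongs to the periodic Sobolev space of order 2 with
   period 2L, and f', f'' represent its first and second weak derivatives. The weak
   derivatives are taken on the whole line, so f and f' cannot jump at odd multiples
   of L. Any two choices of f', f'' agree almost everywhere. *)
definition H2_per ::
    "real \<Rightarrow> (real \<Rightarrow> real) \<Rightarrow> (real \<Rightarrow> real) \<Rightarrow> (real \<Rightarrow> real) \<Rightarrow> bool" where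
  "H2_per L f f' f'' \<longleftrightarrow>
     periodic_fun_simple f (2 * L) \<and>
     f has_weak_derivative f' \<and> f' has_weak_derivative f'' \<and>
     f square_integrable_on {-L..L} \<and> f' square_integrable_on {-L..L} \<and>
     f'' square_integrable_on {-L..L}"

(* The norm on [-L,L] of an f with "H2_per L f f' f''". *)
definition H2_norm ::
    "real \<Rightarrow> (real \<Rightarrow> real) \<Rightarrow> (real \<Rightarrow> real) \<Rightarrow> (real \<Rightarrow> real) \<Rightarrow> real" where
  "H2_norm L f f' f'' =
     sqrt ((LINT x:{-L..L}|lebesgue. (f x)\<^sup>2) + (LINT x:{-L..L}|lebesgue. (f' x)\<^sup>2) +
           (LINT x:{-L..L}|lebesgue. (f'' x)\<^sup>2))"

(* "C2_on a b u u' u''": u is twice continuously differentiable on [a,b] with derivatives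
   u', u''; the derivatives are one-sided at the endpoints. *)
definition C2_on ::
    "real \<Rightarrow> real \<Rightarrow> (real \<Rightarrow> real) \<Rightarrow> (real \<Rightarrow> real) \<Rightarrow> (real \<Rightarrow> real) \<Rightarrow> bool" where
  "C2_on a b u u' u'' \<longleftrightarrow>
     (\<forall>x\<in>{a..b}. (u has_real_derivative u' x) (at x within {a..b})) \<and>
     (\<forall>x\<in>{a..b}. (u' has_real_derivative u'' x) (at x within {a..b})) \<and>
     continuous_on {a..b} u''"

end

theory Submission
  imports Defs
begin

text \<open>
Away from the origin the flow has constant slope 19, which is enough to absorb the destabilising
term: an interpolation inequality bounds \<open>\<integral> u'\<^sup>2\<close> by \<open>\<integral> u''\<^sup>2 / 6 + 18 \<integral> u\<^sup>2\<close>, with no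
boundary condition at \<open>\<plusminus>L\<close> (\<open>interpolation\<close>). Zero mean then forces a negative mass \<open>- 38 L\<close>
of \<open>\<phi>\<^sub>x\<close> somewhere, and the condition \<open>u 0 = 0\<close> makes it affordable at the origin.

The mass is carried by a well of width \<open>e\<close>, \<open>\<phi>\<^sub>x = 19 + w (x / e) / (44 e\<^sup>4)\<close>. The power
\<open>e\<^sup>4\<close> is the scaling under which the potential competes with \<open>u''\<^sup>2\<close> at every width, and
the mean condition becomes \<open>e\<^sup>3 = \<kappa> / L\<close> for a fixed \<open>\<kappa>\<close>. Since \<open>\<phi>\<^sub>x\<^sub>x\<close> has size
\<open>e\<close> to the power \<open>-5\<close> on an interval of length \<open>2 e\<close>, its squared norm is of order \<open>e\<close> to the power
\<open>-9\<close>, that is \<open>L\<^sup>3\<close>; the function \<open>\<phi>\<close>, which is of size \<open>L\<close>, contributes the same order.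

It remains to see that \<open>\<integral> u''\<^sup>2 / 2 + w (x / e) u\<^sup>2 / (44 e\<^sup>4) \<ge> 0\<close> when \<open>u 0 = 0\<close>
(\<open>well_form_bound\<close>). Functions that barely bend are almost linear, \<open>u x \<approx> a x\<close>, because
\<open>u 0 = 0\<close>. For these the form is \<open>a\<^sup>2 \<integral> w (x / e) x\<^sup>2\<close>, so it suffices that the second
moment of \<open>w\<close> be positive. This does not conflict with a negative mean: \<open>w\<close> is negative near
the origin, where \<open>x\<^sup>2\<close> is small, and positive further out. The deviation from the linear function
is controlled by \<open>\<integral> u''\<^sup>2\<close>, and the factor 1/44 makes its contribution harmless.

The profile \<open>w\<close> vanishes to second order at the ends of its support, so that \<open>\<phi>\<close> is
twice continuously differentiable and the weak derivatives are the classical ones.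
\<close>

section \<open>Classical derivatives are weak derivatives\<close>

lemma locally_integrable_continuous:
  assumes "continuous_on UNIV f"
  shows "locally_integrable f"
  unfolding locally_integrable_def
  using assms by (auto intro!: absolutely_integrable_continuous_real continuous_on_subset[OF assms])

lemma square_integrable_on_continuous:
  assumes "continuous_on UNIV f"
  shows "f square_integrable_on {a..b}"
proof -
  have "set_integrable lebesgue {a..b} f"
    by (intro absolutely_integrable_continuous_real continuous_on_subset[OF assms]) auto
  then have "set_borel_measurable lebesgue {a..b} f"
    unfolding set_integrable_def set_borel_measurable_def by (rule borel_measurable_integrable)
  moreover have "set_integrable lebesgue {a..b} (\<lambda>x. (f x)\<^sup>2)"
    by (intro absolutely_integrable_continuous_real continuous_intros continuous_on_subset[OF assms]) auto
  ultimately show ?thesis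
    unfolding square_integrable_on_def by blast
qed

lemma LINT_continuous_eq_integral:
  fixes f :: "real \<Rightarrow> real"
  assumes "continuous_on {a..b} f"
  shows "(LINT x:{a..b}|lebesgue. f x) = integral {a..b} f"
  by (rule set_lebesgue_integral_eq_integral(2), rule absolutely_integrable_continuous_real, rule assms)

lemma LINT_compact_support:
  fixes h :: "real \<Rightarrow> real"
  assumes "continuous_on UNIV h" and "\<And>x. x \<notin> {a..b} \<Longrightarrow> h x = 0"
  shows "(LINT x|lebesgue. h x) = integral {a..b} h"
proof -
  have "(LINT x|lebesgue. h x) = (LINT x:{a..b}|lebesgue. h x)"
    unfolding set_lebesgue_integral_def
    using assms(2) by (intro Bochner_Integration.integral_cong) (auto simp: indicator_def simp del: atLeastAtMost_iff)
  then show ?thesis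
    using LINT_continuous_eq_integral continuous_on_subset[OF assms(1)] by simp
qed

lemma DERIV_imp_weak_derivative:
  assumes f: "\<And>x. (f has_real_derivative g x) (at x)" and g: "continuous_on UNIV g"
  shows "f has_weak_derivative g"
proof -
  have f_cont: "continuous_on UNIV f"
    using f by (meson DERIV_isCont continuous_at_imp_continuous_on)
  have "(LINT x|lebesgue. f x * deriv \<psi> x) = - (LINT x|lebesgue. g x * \<psi> x)"
    if \<psi>: "test_function \<psi>" for \<psi>
  proof -
    have "(deriv ^^ 0) \<psi> differentiable_on UNIV" "(deriv ^^ 1) \<psi> differentiable_on UNIV"
      using \<psi> unfolding test_function_def by blast+
    then have diff: "\<psi> differentiable_on UNIV" "deriv \<psi> differentiable_on UNIV"
      by simp_all
    then have cont: "continuous_on UNIV \<psi>" "continuous_on UNIV (deriv \<psi>)"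
      by (simp_all add: differentiable_imp_continuous_on)
    have der: "(\<psi> has_real_derivative deriv \<psi> x) (at x)" for x
      using diff(1) by (simp add: differentiable_on_def DERIV_deriv_iff_real_differentiable)
    have "bounded (closure {x. \<psi> x \<noteq> 0})"
      using \<psi> unfolding test_function_def by (simp add: compact_imp_bounded)
    then obtain R where R: "\<And>x. x \<in> closure {x. \<psi> x \<noteq> 0} \<Longrightarrow> norm x \<le> R"
      unfolding bounded_iff by blast
    have zero: "\<psi> x = 0" if "\<bar>x\<bar> > R" for x
      using that R[of x] closure_subset[of "{x. \<psi> x \<noteq> 0}"] by fastforce
    have zero': "deriv \<psi> x = 0" if x: "\<bar>x\<bar> > R" for x
    proof -
      have "open {y::real. \<bar>y\<bar> > R}"
        by (intro open_Collect_less continuous_intros)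
      then have "((\<lambda>_. 0) has_real_derivative deriv \<psi> x) (at x)"
        by (rule has_field_derivative_transform_within_open[OF der]) (use x zero in auto)
      then show ?thesis
        using DERIV_unique DERIV_const by blast
    qed
    define S where "S = max R 0"
    \<comment> \<open>The endpoints lie strictly beyond the support, so the boundary terms below vanish.\<close>
    have S1: "\<bar>S + 1\<bar> > R" "\<bar>- (S + 1)\<bar> > R" "- (S+1) \<le> S + 1"
      by (auto simp: S_def)
    have out1: "\<bar>x\<bar> > R" if "x \<notin> {-(S+1)..S+1}" for x
      using that by (auto simp: S_def)
    have I1: "(LINT x|lebesgue. f x * deriv \<psi> x) = integral {-(S+1)..S+1} (\<lambda>x. f x * deriv \<psi> x)"
      by (rule LINT_compact_support) (use f_cont cont zero' out1 in \<open>auto intro!: continuous_intros\<close>)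
    have I2: "(LINT x|lebesgue. g x * \<psi> x) = integral {-(S+1)..S+1} (\<lambda>x. g x * \<psi> x)"
      by (rule LINT_compact_support) (use g cont zero out1 in \<open>auto intro!: continuous_intros\<close>)
    have "((\<lambda>x. f x * deriv \<psi> x + g x * \<psi> x) has_integral
            (f (S+1) * \<psi> (S+1) - f (-(S+1)) * \<psi> (-(S+1)))) {-(S+1)..S+1}"
    proof (rule fundamental_theorem_of_calculus[OF S1(3)])
      fix x assume "x \<in> {-(S+1)..S+1}"
      have "((\<lambda>x. f x * \<psi> x) has_real_derivative (f x * deriv \<psi> x + g x * \<psi> x)) (at x)"
        using DERIV_mult[OF f der, of x] by (simp add: algebra_simps)
      then show "((\<lambda>x. f x * \<psi> x) has_vector_derivative (f x * deriv \<psi> x + g x * \<psi> x))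
                   (at x within {-(S+1)..S+1})"
        by (simp add: has_real_derivative_iff_has_vector_derivative has_vector_derivative_at_within)
    qed
    then have "integral {-(S+1)..S+1} (\<lambda>x. f x * deriv \<psi> x + g x * \<psi> x) = 0"
      using zero[OF S1(1)] zero[OF S1(2)] by (simp add: integral_unique)
    moreover have "integral {-(S+1)..S+1} (\<lambda>x. f x * deriv \<psi> x + g x * \<psi> x)
        = integral {-(S+1)..S+1} (\<lambda>x. f x * deriv \<psi> x) + integral {-(S+1)..S+1} (\<lambda>x. g x * \<psi> x)"
      by (intro integral_add integrable_continuous_interval continuous_intros)
         (auto intro: continuous_on_subset f_cont cont g)
    ultimately show ?thesis
      using I1 I2 by linarith
  qed
  then show ?thesis
    unfolding has_weak_derivative_def
    using locally_integrable_continuous f_cont g by blast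
qed

section \<open>Periodic extension\<close>

text \<open>
The representative of \<open>x\<close> modulo \<open>2 L\<close> in \<open>[-L, L)\<close>; composing with it extends a function
on \<open>[-L, L)\<close> periodically.
\<close>

definition wrap :: "real \<Rightarrow> real \<Rightarrow> real" where
  "wrap L x = x - 2 * L * of_int \<lfloor>(x + L) / (2 * L)\<rfloor>"

lemma wrap_bounds:
  assumes "L > 0"
  shows "- L \<le> wrap L x" "wrap L x < L"
proof -
  have "of_int \<lfloor>(x + L) / (2 * L)\<rfloor> \<le> (x + L) / (2 * L)"
       "(x + L) / (2 * L) < of_int \<lfloor>(x + L) / (2 * L)\<rfloor> + 1"
    by linarith+
  then have "of_int \<lfloor>(x + L) / (2 * L)\<rfloor> * (2 * L) \<le> x + L"
       "x + L < (of_int \<lfloor>(x + L) / (2 * L)\<rfloor> + 1) * (2 * L)"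
    using assms by (simp_all only: pos_le_divide_eq pos_divide_less_eq mult_pos_pos zero_less_numeral)
  then show "- L \<le> wrap L x" "wrap L x < L"
    by (simp_all add: wrap_def algebra_simps)
qed

lemma wrap_eqI:
  assumes "L > 0" "- L \<le> x - 2 * L * of_int k" "x - 2 * L * of_int k < L"
  shows "wrap L x = x - 2 * L * of_int k"
proof -
  have "\<lfloor>(x + L) / (2 * L)\<rfloor> = k"
    using assms by (intro floor_unique) (simp_all add: field_simps)
  then show ?thesis
    by (simp add: wrap_def)
qed

lemma wrap_periodic:
  assumes "L > 0"
  shows "periodic_fun_simple (\<lambda>x. g (wrap L x)) (2 * L)"
proof
  fix x
  have "wrap L (x + 2 * L) = x + 2 * L - 2 * L * of_int (\<lfloor>(x + L) / (2 * L)\<rfloor> + 1)"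
    by (rule wrap_eqI) (use assms wrap_bounds[OF assms, of x] in \<open>auto simp: wrap_def algebra_simps\<close>)
  then have "wrap L (x + 2 * L) = wrap L x"
    by (simp add: wrap_def [of L x] algebra_simps)
  then show "g (wrap L (x + 2 * L)) = g (wrap L x)"
    by simp
qed

text \<open>
If \<open>g\<close> already repeats itself around the seam, the jump of \<open>wrap\<close> there is invisible: near
every point, \<open>g \<circ> wrap\<close> is a translate of \<open>g\<close>. Every local property of \<open>g\<close> therefore
passes to the periodic extension.
\<close>

lemma wrap_locally_shift:
  assumes "0 < e" "e < L" and match: "\<And>x. e < x \<Longrightarrow> x < 2 * L - e \<Longrightarrow> g x = g (x - 2 * L)"
  shows "\<exists>U k. open U \<and> x \<in> U \<and> wrap L x = x - 2 * L * of_int k \<and>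
      (\<forall>y\<in>U. g (wrap L y) = g (y - 2 * L * of_int k))"
proof -
  define k where "k = \<lfloor>(x + L) / (2 * L)\<rfloor>"
  have wx: "wrap L x = x - 2 * L * of_int k"
    by (simp add: wrap_def k_def)
  have bx: "- L \<le> x - 2 * L * of_int k" "x - 2 * L * of_int k < L"
    using wrap_bounds[of L x] assms wx by auto
  let ?U = "{2 * L * of_int k - L - (L - e) <..< 2 * L * of_int k + L}"
  have "g (wrap L y) = g (y - 2 * L * of_int k)" if "y \<in> ?U" for y
  proof (cases "- L \<le> y - 2 * L * of_int k")
    case True
    then show ?thesis
      using that assms by (subst wrap_eqI[of L y k]) auto
  next
    case False
    \<comment> \<open>Left of the seam \<open>wrap\<close> uses \<open>k - 1\<close>; the matching condition repairs the difference.\<close>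
    have "wrap L y = y - 2 * L * of_int (k - 1)"
      by (rule wrap_eqI) (use that False assms in \<open>auto simp: algebra_simps\<close>)
    moreover have "g (y - 2 * L * of_int (k - 1)) = g (y - 2 * L * of_int (k - 1) - 2 * L)"
      by (rule match) (use that False assms in \<open>auto simp: algebra_simps\<close>)
    moreover have "y - 2 * L * of_int (k - 1) - 2 * L = y - 2 * L * of_int k"
      by (simp add: algebra_simps)
    ultimately show ?thesis
      by metis
  qed
  moreover have "x \<in> ?U"
    using bx assms by auto
  ultimately show ?thesis
    using wx open_greaterThanLessThan by blast
qed

lemma wrap_has_derivative:
  assumes "0 < e" "e < L" and "\<And>x. e < x \<Longrightarrow> x < 2 * L - e \<Longrightarrow> g x = g (x - 2 * L)"
    and g: "\<And>x. (g has_real_derivative g' x) (at x)"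
  shows "((\<lambda>x. g (wrap L x)) has_real_derivative g' (wrap L x)) (at x)"
proof -
  obtain U k where U: "open U" "x \<in> U" "wrap L x = x - 2 * L * of_int k"
    "\<And>y. y \<in> U \<Longrightarrow> g (wrap L y) = g (y - 2 * L * of_int k)"
    using wrap_locally_shift[where g = g, OF assms(1-3)] by metis
  have "((\<lambda>y. g (y - 2 * L * of_int k)) has_real_derivative g' (x - 2 * L * of_int k) * 1) (at x)"
    by (rule DERIV_chain2[OF g]) (auto intro!: derivative_eq_intros)
  then show ?thesis
    using has_field_derivative_transform_within_open[OF _ U(1,2)] U(3,4) by simp
qed

lemma wrap_continuous:
  assumes "0 < e" "e < L" and "\<And>x. e < x \<Longrightarrow> x < 2 * L - e \<Longrightarrow> g x = g (x - 2 * L)"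
    and g: "continuous_on UNIV g"
  shows "continuous_on UNIV (\<lambda>x. g (wrap L x))"
proof (intro continuous_at_imp_continuous_on ballI)
  fix x
  obtain U k where U: "open U" "x \<in> U"
    "\<And>y. y \<in> U \<Longrightarrow> g (wrap L y) = g (y - 2 * L * of_int k)"
    using wrap_locally_shift[where g = g, OF assms(1-3)] by metis
  have "continuous_on U (\<lambda>y. g (y - 2 * L * of_int k))"
    by (rule continuous_on_compose2[OF g]) (auto intro!: continuous_intros)
  then have "continuous_on U (\<lambda>x. g (wrap L x))"
    using U(3) by (simp cong: continuous_on_cong)
  then show "isCont (\<lambda>x. g (wrap L x)) x"
    using U continuous_on_eq_continuous_at by blast
qed

section \<open>A well with negative mean and positive second moment\<close>

text \<open>
Composing with the retraction onto \<open>[-1, 1]\<close> continues a function by constants. If the derivative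
vanishes at \<open>\<plusminus>1\<close>, it is truncated by the same map, so no piecewise definitions arise.
\<close>

definition cut :: "real \<Rightarrow> real" where
  "cut y = max (-1) (min 1 y)"

lemma continuous_on_cut: "continuous_on S cut"
  unfolding cut_def by (intro continuous_intros)

lemma abs_cut_le: "\<bar>cut y\<bar> \<le> 1"
  by (auto simp: cut_def)

lemma cut_id: "\<bar>y\<bar> \<le> 1 \<Longrightarrow> cut y = y"
  by (auto simp: cut_def)

lemma cut_ge: "y \<ge> 1 \<Longrightarrow> cut y = 1" and cut_le: "y \<le> - 1 \<Longrightarrow> cut y = - 1"
  by (auto simp: cut_def)

text \<open>
At an end of \<open>[-1, 1]\<close> every difference quotient of \<open>p \<circ> cut\<close> is either zero or a difference
quotient of \<open>p\<close>.
\<close>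

lemma cut_derivative_flat:
  assumes p: "(p has_real_derivative 0) (at z)" and z: "cut z = z" "\<bar>z\<bar> = 1"
  shows "((\<lambda>y. p (cut y)) has_real_derivative 0) (at z)"
proof -
  have lim: "((\<lambda>y. (p y - p z) / (y - z)) \<longlongrightarrow> 0) (at z)"
    using p by (simp add: has_field_derivative_iff)
  have "eventually (\<lambda>y. y \<in> ball z 1) (at z)"
    by (intro eventually_at_in_open') auto
  then have "eventually (\<lambda>y. norm ((p (cut y) - p (cut z)) / (y - z)) \<le> norm ((p y - p z) / (y - z))) (at z)"
  proof eventually_elim
    case (elim y)
    then have "cut y = y \<or> cut y = z"
      using z by (auto simp: cut_def dist_real_def)
    then show ?case
      using z by auto
  qed
  then have "((\<lambda>y. (p (cut y) - p (cut z)) / (y - z)) \<longlongrightarrow> 0) (at z)"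
    by (rule Lim_null_comparison) (use tendsto_norm[OF lim] in simp)
  then show ?thesis
    by (simp add: has_field_derivative_iff)
qed

lemma cut_derivative:
  assumes p: "\<And>y. (p has_real_derivative p' y) (at y)" and "p' 1 = 0" "p' (-1) = 0"
  shows "((\<lambda>y. p (cut y)) has_real_derivative p' (cut y)) (at y)"
proof -
  consider "\<bar>y\<bar> < 1" | "y > 1" | "y < - 1" | "y = 1 \<or> y = - 1"
    by linarith
  then show ?thesis
  proof cases
    case 1
    have "((\<lambda>y. p (cut y)) has_real_derivative p' y) (at y)"
      by (rule has_field_derivative_transform_within_open[OF p, of "{-1<..<1}"])
         (use 1 in \<open>auto simp: cut_id\<close>)
    then show ?thesis
      using 1 by (simp add: cut_id)
  next
    case 2
    have "((\<lambda>y. p (cut y)) has_real_derivative 0) (at y)"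
      by (rule has_field_derivative_transform_within_open[OF DERIV_const, of "{1<..}" _ "p 1"])
         (use 2 in \<open>auto simp: cut_ge\<close>)
    then show ?thesis
      using 2 assms by (simp add: cut_ge)
  next
    case 3
    have "((\<lambda>y. p (cut y)) has_real_derivative 0) (at y)"
      by (rule has_field_derivative_transform_within_open[OF DERIV_const, of "{..<-1}" _ "p (-1)"])
         (use 3 in \<open>auto simp: cut_le\<close>)
    then show ?thesis
      using 3 assms by (simp add: cut_le)
  next
    case 4
    then have "cut y = y" "\<bar>y\<bar> = 1" "p' y = 0"
      using assms by (auto simp: cut_def)
    then show ?thesis
      using cut_derivative_flat[of p y] p[of y] by simp
  qed
qed

text \<open>
Among the even profiles \<open>(1 - y\<^sup>2)\<^sup>2 (b y\<^sup>2 - 1)\<close> the mean over \<open>[-1, 1]\<close> is negative for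
\<open>b < 7\<close> and the second moment positive for \<open>b > 3\<close>; the choice is \<open>b = 5\<close>. The other two
functions are its odd antiderivative and its derivative.
\<close>

definition well_prim :: "real \<Rightarrow> real" where
  "well_prim y = 5/7 * y^7 - 11/5 * y^5 + 7/3 * y^3 - y"

definition well :: "real \<Rightarrow> real" where
  "well y = (1 - y\<^sup>2)\<^sup>2 * (5 * y\<^sup>2 - 1)"

definition well_deriv :: "real \<Rightarrow> real" where
  "well_deriv y = 30 * y^5 - 44 * y^3 + 14 * y"

lemma well_expand: "well y = 5 * y^6 - 11 * y^4 + 7 * y^2 - 1"
  unfolding well_def by algebra

lemma DERIV_well_prim: "(well_prim has_real_derivative well y) (at y)"
  unfolding well_prim_def [abs_def] well_expand
  by (auto intro!: derivative_eq_intros)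

lemma DERIV_well: "(well has_real_derivative well_deriv y) (at y)"
  unfolding well_expand [abs_def] well_deriv_def
  by (auto intro!: derivative_eq_intros)

lemma continuous_on_well [continuous_intros]:
  "continuous_on S f \<Longrightarrow> continuous_on S (\<lambda>x. well (f x))"
  unfolding well_def by (intro continuous_intros)

lemma continuous_on_well_deriv [continuous_intros]:
  "continuous_on S f \<Longrightarrow> continuous_on S (\<lambda>x. well_deriv (f x))"
  unfolding well_deriv_def by (intro continuous_intros)

lemma well_at_ends: "well 1 = 0" "well (-1) = 0" "well_deriv 1 = 0" "well_deriv (-1) = 0"
    "well_prim 1 = - 16/105" "well_prim (-1) = 16/105"
  by (simp_all add: well_def well_deriv_def well_prim_def)

lemma abs_well_le:
  assumes "\<bar>y\<bar> \<le> 1"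
  shows "\<bar>well y\<bar> \<le> 1"
proof -
  define s where "s = y\<^sup>2"
  have s: "0 \<le> s" "s \<le> 1"
    using assms by (auto simp: s_def abs_square_le_1)
  have "(1 - s)\<^sup>2 * (5 * s - 1) \<ge> -1"
  proof -
    have "(1 - s)\<^sup>2 * (5 * s - 1) + 1 = s * (5 * (1 - s)\<^sup>2 + (2 - s))"
      by algebra
    also have "\<dots> \<ge> 0"
      using s by (intro mult_nonneg_nonneg add_nonneg_nonneg) auto
    finally show ?thesis by linarith
  qed
  moreover have "(1 - s)\<^sup>2 * (5 * s - 1) \<le> 1"
  proof -
    have "(1 - s)\<^sup>2 * (5 * s - 1) = (1 - s) * ((1 - s) * (5 * s - 1))"
      by algebra
    moreover have "(1 - s) * (5 * s - 1) \<le> 1"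
    proof -
      have "1 - (1 - s) * (5 * s - 1) = 5 * (s - 3/5)\<^sup>2 + 1/5"
        by (simp add: power2_eq_square algebra_simps)
      then show ?thesis
        using zero_le_power2[of "s - 3/5"] by linarith
    qed
    ultimately show ?thesis
      using s by (smt (verit, best) mult_left_le mult_left_mono)
  qed
  ultimately show ?thesis
    by (simp add: well_def s_def)
qed

lemma abs_well_deriv_le:
  assumes "\<bar>y\<bar> \<le> 1"
  shows "\<bar>well_deriv y\<bar> \<le> 88"
proof -
  have "\<bar>y^n\<bar> \<le> 1" for n
    using assms by (simp add: power_abs power_le_one)
  from this[of 5] this[of 3] assms show ?thesis
    unfolding well_deriv_def by linarith
qed

lemma abs_well_prim_le:
  assumes "\<bar>y\<bar> \<le> 1"
  shows "\<bar>well_prim y\<bar> \<le> 7"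
proof -
  have "\<bar>y^n\<bar> \<le> 1" for n
    using assms by (simp add: power_abs power_le_one)
  from this[of 7] this[of 5] this[of 3] assms show ?thesis
    unfolding well_prim_def by linarith
qed

text \<open>
The shift by 1/10 leaves room for the mixed terms in \<open>well_form_bound\<close>: the second moment stays
positive.
\<close>

lemma well_second_moment:
  assumes "e > 0"
  shows "((\<lambda>x. (well (x / e) - 1/10) * x\<^sup>2) has_integral (11/315 * e^3)) {-e..e}"
proof -
  define G where "G = (\<lambda>y::real. 5/9 * y^9 - 11/7 * y^7 + 7/5 * y^5 - 11/30 * y^3)"
  have G: "(G has_real_derivative (well y - 1/10) * y\<^sup>2) (at y)" for y
    unfolding G_def well_expand
    by (auto intro!: derivative_eq_intros simp: algebra_simps simp flip: power_add)
  have "((\<lambda>x. (well (x / e) - 1/10) * x\<^sup>2) has_integral (e^3 * G (e / e) - e^3 * G (-e / e))) {-e..e}"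
  proof (rule fundamental_theorem_of_calculus)
    fix x
    have "((\<lambda>x. x / e) has_real_derivative 1 / e) (at x)"
      using assms by (auto intro!: derivative_eq_intros)
    then have "((\<lambda>x. e^3 * G (x / e)) has_real_derivative e^3 * ((well (x / e) - 1/10) * (x / e)\<^sup>2 * (1 / e))) (at x)"
      using DERIV_cmult[OF DERIV_chain2[OF G]] by blast
    also have "e^3 * ((well (x / e) - 1/10) * (x / e)\<^sup>2 * (1 / e)) = (well (x / e) - 1/10) * x\<^sup>2"
      using assms by (simp add: power2_eq_square power3_eq_cube)
    finally show "((\<lambda>x. e^3 * G (x / e)) has_vector_derivative (well (x / e) - 1/10) * x\<^sup>2) (at x within {-e..e})"
      by (simp add: has_real_derivative_iff_has_vector_derivative has_vector_derivative_at_within)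
  qed (use assms in auto)
  moreover have "e^3 * G (e / e) - e^3 * G (-e / e) = 11/315 * e^3"
    using assms by (simp add: G_def algebra_simps)
  ultimately show ?thesis by metis
qed

section \<open>Two integral inequalities\<close>

lemma C2_on_continuous:
  assumes "C2_on a b u u' u''"
  shows "continuous_on {a..b} u" "continuous_on {a..b} u'" "continuous_on {a..b} u''"
  using assms unfolding C2_on_def by (auto intro!: DERIV_continuous_on)

lemma C2_on_subset:
  assumes "C2_on a b u u' u''" "a \<le> c" "d \<le> b"
  shows "C2_on c d u u' u''"
proof -
  have "{c..d} \<subseteq> {a..b}"
    using assms by auto
  with assms(1) show ?thesis
    unfolding C2_on_def by (meson DERIV_subset continuous_on_subset subsetD)
qed

text \<open>The variance of \<open>f\<close> is nonnegative.\<close>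

lemma integral_Cauchy_Schwarz:
  fixes f :: "real \<Rightarrow> real"
  assumes f: "continuous_on {a..b} f" and "a \<le> b"
  shows "(integral {a..b} f)\<^sup>2 \<le> (b - a) * integral {a..b} (\<lambda>x. (f x)\<^sup>2)"
proof (cases "a = b")
  case False
  then have ab: "b - a > 0"
    using assms by simp
  define I J m where "I = integral {a..b} f" and "J = integral {a..b} (\<lambda>x. (f x)\<^sup>2)"
    and "m = I / (b - a)"
  have "(f has_integral I) {a..b}" "((\<lambda>x. (f x)\<^sup>2) has_integral J) {a..b}"
    unfolding I_def J_def
    by (auto intro!: integrable_integral integrable_continuous_interval continuous_intros f)
  then have "((\<lambda>x. (f x)\<^sup>2 - 2 * m * f x + m\<^sup>2) has_integral (J - 2 * m * I + m\<^sup>2 * (b - a))) {a..b}"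
    using has_integral_const_real[of "m\<^sup>2" a b] assms
    by (intro has_integral_add has_integral_diff has_integral_mult_right) (auto simp: mult.commute)
  moreover have "(f x)\<^sup>2 - 2 * m * f x + m\<^sup>2 \<ge> 0" for x
    using zero_le_power2[of "f x - m"] by (simp add: power2_eq_square algebra_simps)
  ultimately have "J - 2 * m * I + m\<^sup>2 * (b - a) \<ge> 0"
    using has_integral_nonneg by blast
  moreover have "I = m * (b - a)"
    using ab by (simp add: m_def)
  then have "m\<^sup>2 * (b - a) = m * I"
    by (simp add: power2_eq_square)
  ultimately have "m * I \<le> J"
    by linarith
  then have "(b - a) * (m * I) \<le> (b - a) * J"
    using ab by (intro mult_left_mono) auto
  moreover have "(b - a) * (m * I) = I\<^sup>2"
    using ab by (simp add: m_def power2_eq_square)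
  ultimately show ?thesis
    by (simp add: I_def J_def)
qed auto

text \<open>
The square of \<open>u'' + p u' + 9 u\<close> has, up to a total derivative \<open>F'\<close>, only diagonal terms. With
constant \<open>p\<close>, the boundary form \<open>p u'\<^sup>2 + 18 u u' + 9 p u\<^sup>2\<close> is semidefinite exactly when
\<open>\<bar>p\<bar> \<ge> 3\<close>, and the right signs at the two ends are \<open>p (-L) = 3\<close> and \<open>p L = -3\<close>.
Interpolating linearly, \<open>p x = - 3 x / L\<close>, costs only the small term \<open>p' = - 3 / L\<close> and gives
the boundary contribution a sign that allows dropping it.
\<close>

lemma interpolation:
  assumes L: "L \<ge> 1" and u: "C2_on (-L) L u u' u''"
  shows "6 * integral {-L..L} (\<lambda>x. (u' x)\<^sup>2)
    \<le> integral {-L..L} (\<lambda>x. (u'' x)\<^sup>2) + 108 * integral {-L..L} (\<lambda>x. (u x)\<^sup>2)"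
proof -
  let ?I = "{-L..L}"
  define p where "p x = - 3 * x / L" for x
  define F where "F x = p x * (u' x)\<^sup>2 + 18 * u x * u' x + 9 * p x * (u x)\<^sup>2" for x
  define G where "G x = - 3 / L * (u' x)\<^sup>2 + p x * (2 * u' x * u'' x) + 18 * (u' x * u' x + u x * u'' x)
     + 9 * (- 3 / L * (u x)\<^sup>2 + p x * (2 * u x * u' x))" for x
  have c: "continuous_on ?I u" "continuous_on ?I u'" "continuous_on ?I u''"
    using C2_on_continuous[OF u] by auto
  have "(G has_integral (F L - F (-L))) ?I"
  proof (rule fundamental_theorem_of_calculus)
    fix x assume x: "x \<in> ?I"
    have [derivative_intros]: "(p has_real_derivative - 3 / L) (at x within ?I)"
      unfolding p_def using L by (auto intro!: derivative_eq_intros)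
    have [derivative_intros]: "(u has_real_derivative u' x) (at x within ?I)"
       "(u' has_real_derivative u'' x) (at x within ?I)"
      using u x unfolding C2_on_def by auto
    have "(F has_real_derivative G x) (at x within ?I)"
      unfolding F_def G_def by (rule derivative_eq_intros refl)+ (simp add: algebra_simps)
    then show "(F has_vector_derivative G x) (at x within ?I)"
      by (simp add: has_real_derivative_iff_has_vector_derivative)
  qed (use L in auto)
  moreover have "F L - F (-L) \<le> 0"
  proof -
    have "F L - F (-L) = - 3 * (u' L - 3 * u L)\<^sup>2 - 3 * (u' (-L) + 3 * u (-L))\<^sup>2"
      using L by (simp add: F_def p_def power2_eq_square algebra_simps)
    then show ?thesis
      by simp
  qed
  moreover define A B C where "A = integral ?I (\<lambda>x. (u'' x)\<^sup>2)"
    and "B = integral ?I (\<lambda>x. (u' x)\<^sup>2)" and "C = integral ?I (\<lambda>x. (u x)\<^sup>2)"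
  have ABC: "((\<lambda>x. (u'' x)\<^sup>2) has_integral A) ?I" "((\<lambda>x. (u' x)\<^sup>2) has_integral B) ?I"
    "((\<lambda>x. (u x)\<^sup>2) has_integral C) ?I"
    unfolding A_def B_def C_def
    by (auto intro!: integrable_integral integrable_continuous_interval continuous_intros c)
  ultimately have *: "((\<lambda>x. (u'' x)\<^sup>2 - 6 * (u' x)\<^sup>2 + 108 * (u x)\<^sup>2 + G x) has_integral
      (A - 6 * B + 108 * C + (F L - F (-L)))) ?I"
    by (intro has_integral_add has_integral_diff has_integral_mult_right)
  have "A - 6 * B + 108 * C + (F L - F (-L)) \<ge> 0"
  proof (rule has_integral_nonneg[OF *])
    fix x assume x: "x \<in> ?I"
    have pp: "(p x)\<^sup>2 \<le> 9"
    proof -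
      have "\<bar>p x\<bar> \<le> 3"
        using x L by (auto simp: p_def abs_mult divide_simps)
      then show ?thesis
        using power_mono[of "\<bar>p x\<bar>" 3 2] by simp
    qed
    have l: "3 / L \<le> 3"
      using L by (simp add: divide_simps)
    have "(u'' x)\<^sup>2 - 6 * (u' x)\<^sup>2 + 108 * (u x)\<^sup>2 + G x =
      (u'' x + p x * u' x + 9 * u x)\<^sup>2 + (9 - (p x)\<^sup>2 + (3 - 3 / L)) * (u' x)\<^sup>2 + 9 * (3 - 3 / L) * (u x)\<^sup>2"
      unfolding G_def by (simp add: power2_eq_square algebra_simps)
    also have "\<dots> \<ge> 0"
      using pp l by (intro add_nonneg_nonneg mult_nonneg_nonneg) auto
    finally show "(u'' x)\<^sup>2 - 6 * (u' x)\<^sup>2 + 108 * (u x)\<^sup>2 + G x \<ge> 0" .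
  qed
  with \<open>F L - F (-L) \<le> 0\<close> show ?thesis
    by (simp add: A_def B_def C_def)
qed

text \<open>
By Cauchy--Schwarz \<open>u'\<close> varies by at most \<open>sqrt (e \<integral> u''\<^sup>2)\<close> between the origin and any point of
the interval, and \<open>u 0 = 0\<close> removes the constant term.
\<close>

lemma C2_on_deviation:
  assumes u: "C2_on (-e) e u u' u''" and "u 0 = 0" "e > 0" and x: "x \<in> {-e..e}"
  shows "(u x - u' 0 * x)\<^sup>2 \<le> e^3 * integral {-e..e} (\<lambda>x. (u'' x)\<^sup>2)"
proof -
  define D where "D = integral {-e..e} (\<lambda>x. (u'' x)\<^sup>2)"
  have c: "continuous_on {-e..e} u''"
    using C2_on_continuous[OF u] by auto
  have D: "(\<lambda>x. (u'' x)\<^sup>2) integrable_on {-e..e}"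
    by (intro integrable_continuous_interval continuous_intros c)
  then have "D \<ge> 0"
    unfolding D_def by (rule integral_nonneg) auto
  have step: "(u' t - u' s)\<^sup>2 \<le> e * D" if "s \<le> t" "{s..t} \<subseteq> {-e..e}" "t - s \<le> e" for s t
  proof -
    have cs: "continuous_on {s..t} u''"
      using c that continuous_on_subset by blast
    have "(u'' has_integral (u' t - u' s)) {s..t}"
    proof (rule fundamental_theorem_of_calculus[OF \<open>s \<le> t\<close>])
      fix y assume "y \<in> {s..t}"
      then show "(u' has_vector_derivative u'' y) (at y within {s..t})"
        using u that unfolding C2_on_def
        by (meson DERIV_subset has_real_derivative_iff_has_vector_derivative subsetD)
    qed
    then have "(u' t - u' s)\<^sup>2 \<le> (t - s) * integral {s..t} (\<lambda>x. (u'' x)\<^sup>2)"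
      using integral_Cauchy_Schwarz[OF cs \<open>s \<le> t\<close>] by (simp add: integral_unique)
    also have "\<dots> \<le> e * D"
      unfolding D_def using that \<open>e > 0\<close>
      by (intro mult_mono integral_subset_le integral_nonneg D)
         (auto intro!: integrable_continuous_interval continuous_intros cs)
    finally show ?thesis .
  qed
  have dev: "\<bar>u' y - u' 0\<bar> \<le> sqrt (e * D)" if "y \<in> {-e..e}" for y
  proof (rule real_le_rsqrt)
    show "\<bar>u' y - u' 0\<bar>\<^sup>2 \<le> e * D"
      using step[of 0 y] step[of y 0] that \<open>e > 0\<close>
      by (cases "y \<ge> 0") (auto simp: power2_commute)
  qed
  have "norm ((u x - u' 0 * x) - (u 0 - u' 0 * 0)) \<le> sqrt (e * D) * norm (x - 0)"
  proof (rule field_differentiable_bound[of "{-e..e}" "\<lambda>x. u x - u' 0 * x" "\<lambda>x. u' x - u' 0"])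
    fix z assume z: "z \<in> {-e..e}"
    have "(u has_real_derivative u' z) (at z within {-e..e})"
      using u z unfolding C2_on_def by auto
    then show "((\<lambda>x. u x - u' 0 * x) has_real_derivative u' z - u' 0) (at z within {-e..e})"
      by (auto intro!: derivative_eq_intros)
    show "norm (u' z - u' 0) \<le> sqrt (e * D)"
      using dev[OF z] by simp
  qed (use x \<open>e > 0\<close> in auto)
  then have "\<bar>u x - u' 0 * x\<bar> \<le> sqrt (e * D) * \<bar>x\<bar>"
    using \<open>u 0 = 0\<close> by simp
  also have "\<dots> \<le> sqrt (e * D) * e"
    using x \<open>e > 0\<close> \<open>D \<ge> 0\<close> by (intro mult_left_mono) auto
  finally have "\<bar>u x - u' 0 * x\<bar>\<^sup>2 \<le> (sqrt (e * D) * e)\<^sup>2"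
    by (intro power_mono) auto
  also have "\<dots> = e^3 * D"
    using \<open>e > 0\<close> \<open>D \<ge> 0\<close> by (simp add: power_mult_distrib power2_eq_square power3_eq_cube)
  finally show ?thesis
    by (simp add: D_def)
qed

text \<open>
With \<open>u x = a x + r\<close>, the mixed term is split by Young's inequality into \<open>(a x)\<^sup>2 / 10\<close>, which
the second moment of the well absorbs, and a multiple of \<open>r\<^sup>2\<close>, which is at most
\<open>e\<^sup>3 \<integral> u''\<^sup>2\<close>. Integrating over a length \<open>2 e\<close> gives the fourth power of \<open>e\<close>.
\<close>

lemma well_form_bound:
  assumes u: "C2_on (-e) e u u' u''" and "u 0 = 0" "e > 0"
  shows "integral {-e..e} (\<lambda>x. well (x / e) * (u x)\<^sup>2) \<ge> - 22 * e^4 * integral {-e..e} (\<lambda>x. (u'' x)\<^sup>2)"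
proof -
  define a D where "a = u' 0" and "D = integral {-e..e} (\<lambda>x. (u'' x)\<^sup>2)"
  have c: "continuous_on {-e..e} u"
    using C2_on_continuous[OF u] by auto
  have "((\<lambda>x. well (x / e) * (u x)\<^sup>2) has_integral integral {-e..e} (\<lambda>x. well (x / e) * (u x)\<^sup>2)) {-e..e}"
    by (intro integrable_integral integrable_continuous_interval continuous_intros c) (use \<open>e > 0\<close> in auto)
  moreover have "((\<lambda>x. a\<^sup>2 * ((well (x / e) - 1/10) * x\<^sup>2) - 11 * (e^3 * D)) has_integral
      (a\<^sup>2 * (11/315 * e^3) - 11 * (e^3 * D) * (2 * e))) {-e..e}"
    using has_integral_const_real[of "11 * (e^3 * D)" "-e" e] \<open>e > 0\<close>
    by (intro has_integral_diff has_integral_mult_right well_second_moment) (auto simp: mult_ac)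
  ultimately have "a\<^sup>2 * (11/315 * e^3) - 11 * (e^3 * D) * (2 * e)
      \<le> integral {-e..e} (\<lambda>x. well (x / e) * (u x)\<^sup>2)"
  proof (elim has_integral_le[rotated])
    fix x assume x: "x \<in> {-e..e}"
    define q r where "q = well (x / e)" and "r = u x - a * x"
    have q: "\<bar>q\<bar> \<le> 1"
      unfolding q_def using x \<open>e > 0\<close> by (intro abs_well_le) (auto simp: divide_simps)
    have r: "r\<^sup>2 \<le> e^3 * D"
      using C2_on_deviation[OF assms x] by (simp add: r_def a_def D_def)
    have young: "\<bar>2 * (a * x) * r\<bar> \<le> (a * x)\<^sup>2 / 10 + 10 * r\<^sup>2"
    proof -
      have "(a * x + 10 * r)\<^sup>2 \<ge> 0" "(a * x - 10 * r)\<^sup>2 \<ge> 0"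
        by auto
      then show ?thesis
        by (simp add: power2_eq_square algebra_simps abs_le_iff)
    qed
    have "\<bar>q * (2 * (a * x) * r + r\<^sup>2)\<bar> \<le> 1 * ((a * x)\<^sup>2 / 10 + 11 * r\<^sup>2)"
      unfolding abs_mult using q young zero_le_power2[of r] by (intro mult_mono) linarith+
    then have "- (q * (2 * (a * x) * r + r\<^sup>2)) \<le> (a * x)\<^sup>2 / 10 + 11 * r\<^sup>2"
      by (simp only: abs_le_iff mult_1)
    then have "q * (2 * (a * x) * r + r\<^sup>2) \<ge> - ((a * x)\<^sup>2 / 10) - 11 * (e^3 * D)"
      using r by linarith
    moreover have "q * (u x)\<^sup>2 = q * (a * x)\<^sup>2 + q * (2 * (a * x) * r + r\<^sup>2)"
      by (simp add: r_def power2_eq_square algebra_simps)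
    moreover have "a\<^sup>2 * ((q - 1/10) * x\<^sup>2) = q * (a * x)\<^sup>2 - (a * x)\<^sup>2 / 10"
      by (simp add: power2_eq_square algebra_simps)
    ultimately show "a\<^sup>2 * ((well (x / e) - 1/10) * x\<^sup>2) - 11 * (e^3 * D) \<le> well (x / e) * (u x)\<^sup>2"
      unfolding q_def[symmetric] by linarith
  qed
  moreover have "a\<^sup>2 * (11/315 * e^3) \<ge> 0"
    using \<open>e > 0\<close> by simp
  moreover have "11 * (e^3 * D) * (2 * e) = 22 * e^4 * D"
    by (simp add: power_numeral_reduce)
  ultimately have "- (22 * e^4 * D) \<le> integral {-e..e} (\<lambda>x. well (x / e) * (u x)\<^sup>2)"
    by linarith
  then show ?thesis
    by (simp add: D_def)
qed

section \<open>The background flow\<close>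

definition flow :: "real \<Rightarrow> real \<Rightarrow> real" where
  "flow e x = 19 * x + well_prim (cut (x / e)) / (44 * e^3)"

definition flow_x :: "real \<Rightarrow> real \<Rightarrow> real" where
  "flow_x e x = 19 + well (cut (x / e)) / (44 * e^4)"

definition flow_xx :: "real \<Rightarrow> real \<Rightarrow> real" where
  "flow_xx e x = well_deriv (cut (x / e)) / (44 * e^5)"

lemma cut_scaled:
  assumes "e > 0"
  shows "e \<le> x \<Longrightarrow> cut (x / e) = 1" "x \<le> - e \<Longrightarrow> cut (x / e) = - 1"
    "\<bar>x\<bar> \<le> e \<Longrightarrow> cut (x / e) = x / e"
proof -
  show "\<bar>x\<bar> \<le> e \<Longrightarrow> cut (x / e) = x / e"
    using assms by (intro cut_id) simp
qed (use assms in \<open>auto intro!: cut_ge cut_le simp: divide_simps\<close>)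

lemma well_cut_outside:
  assumes "e > 0" "x \<notin> {-e..e}"
  shows "well (cut (x / e)) = 0" "well_deriv (cut (x / e)) = 0"
proof -
  have "cut (x / e) = 1 \<or> cut (x / e) = - 1"
    using assms cut_scaled(1,2)[of e x] by force
  then show "well (cut (x / e)) = 0" "well_deriv (cut (x / e)) = 0"
    by (auto simp: well_at_ends)
qed

lemma DERIV_scaled_cut:
  assumes "e > 0" and "\<And>y. (p has_real_derivative p' y) (at y)" "p' 1 = 0" "p' (-1) = 0"
  shows "((\<lambda>x. p (cut (x / e))) has_real_derivative p' (cut (x / e)) / e) (at x)"
proof -
  have "((\<lambda>x. x / e) has_real_derivative 1 / e) (at x)"
    using assms(1) by (auto intro!: derivative_eq_intros)
  then show ?thesis
    using DERIV_chain2[where f = "\<lambda>y. p (cut y)", OF cut_derivative[where p' = p', OF assms(2-4)]] by force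
qed

lemma DERIV_flow:
  assumes "e > 0"
  shows "(flow e has_real_derivative flow_x e x) (at x)"
  unfolding flow_def [abs_def] flow_x_def using assms
  by (auto intro!: derivative_eq_intros DERIV_scaled_cut[OF assms DERIV_well_prim]
      simp: well_at_ends power_numeral_reduce)

lemma DERIV_flow_x:
  assumes "e > 0"
  shows "(flow_x e has_real_derivative flow_xx e x) (at x)"
  unfolding flow_x_def [abs_def] flow_xx_def using assms
  by (auto intro!: derivative_eq_intros DERIV_scaled_cut[OF assms DERIV_well]
      simp: well_at_ends power_numeral_reduce)

lemma continuous_on_cut_scaled: "e > 0 \<Longrightarrow> continuous_on S (\<lambda>x. cut (x / e))"
  by (rule continuous_on_compose2[OF continuous_on_cut[of UNIV]]) (auto intro!: continuous_intros)

lemma continuous_on_flow_xx: "e > 0 \<Longrightarrow> continuous_on S (flow_xx e)"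
  unfolding flow_xx_def [abs_def] by (intro continuous_intros continuous_on_cut_scaled) auto

lemma continuous_on_flow_x: "e > 0 \<Longrightarrow> continuous_on S (flow_x e)"
  unfolding flow_x_def [abs_def] by (intro continuous_intros continuous_on_cut_scaled) auto

text \<open>
The value of \<open>e\<^sup>3\<close> is the condition of zero mean: the gain \<open>38 L\<close> of the linear part over one
period equals the drop \<open>(32 / 105) / (44 e\<^sup>3)\<close> across the well.
\<close>

lemma flow_matches:
  assumes "e > 0" "e < x" "x < 2 * L - e" "e^3 = 4 / 21945 / L" "L > 0"
  shows "flow e x = flow e (x - 2 * L)" "flow_x e x = flow_x e (x - 2 * L)"
    "flow_xx e x = flow_xx e (x - 2 * L)"
proof -
  have "cut (x / e) = 1" "cut ((x - 2 * L) / e) = - 1"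
    using assms by (auto intro!: cut_scaled)
  then show "flow e x = flow e (x - 2 * L)" "flow_x e x = flow_x e (x - 2 * L)"
    "flow_xx e x = flow_xx e (x - 2 * L)"
    using assms by (simp_all add: flow_def flow_x_def flow_xx_def well_at_ends field_simps)
qed

lemma integral_supported:
  fixes f :: "real \<Rightarrow> real"
  assumes "continuous_on {-e..e} f" "\<And>x. x \<notin> {-e..e} \<Longrightarrow> f x = 0" "e \<le> L"
  shows "(f has_integral integral {-e..e} f) {-L..L}"
  by (rule has_integral_on_superset[of _ _ "{-e..e}"])
     (use assms in \<open>auto intro!: integrable_integral integrable_continuous_interval\<close>)

lemma integral_supported_le:
  fixes f :: "real \<Rightarrow> real"
  assumes f: "continuous_on {-e..e} f" "\<And>x. x \<notin> {-e..e} \<Longrightarrow> f x = 0" and "0 < e" "e \<le> L"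
    and M: "\<And>x. x \<in> {-e..e} \<Longrightarrow> f x \<le> M"
  shows "integral {-L..L} f \<le> 2 * e * M"
proof -
  have "integral {-L..L} f = integral {-e..e} f"
    by (rule integral_unique, rule integral_supported) (use assms in auto)
  also have "\<dots> \<le> integral {-e..e} (\<lambda>_. M)"
    by (intro integral_le integrable_continuous_interval f(1) M continuous_intros)
  also have "\<dots> = 2 * e * M"
    using \<open>0 < e\<close> by simp
  finally show ?thesis .
qed

text \<open>
Of the available \<open>3/4 \<integral> u''\<^sup>2\<close>, the interpolation inequality uses 1/6 and the well 1/2; the slope
19 exceeds \<open>18 + 1/4\<close>.
\<close>

lemma flow_x_coercive:
  assumes e: "0 < e" "e \<le> L" and L: "1 \<le> L" and u: "C2_on (-L) L u u' u''" "u 0 = 0"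
  shows "integral {-L..L} (\<lambda>x. (u'' x)\<^sup>2 - (u' x)\<^sup>2 + flow_x e x * (u x)\<^sup>2)
    \<ge> 1/4 * integral {-L..L} (\<lambda>x. (u'' x)\<^sup>2 + (u x)\<^sup>2)"
proof -
  let ?I = "{-L..L}"
  define A B C W where "A = integral ?I (\<lambda>x. (u'' x)\<^sup>2)"
    and "B = integral ?I (\<lambda>x. (u' x)\<^sup>2)" and "C = integral ?I (\<lambda>x. (u x)\<^sup>2)"
    and "W = integral {-e..e} (\<lambda>x. well (cut (x / e)) * (u x)\<^sup>2)"
  have c: "continuous_on ?I u" "continuous_on ?I u'" "continuous_on ?I u''"
    using C2_on_continuous[OF u(1)] by auto
  have sub: "{-e..e} \<subseteq> ?I"
    using e by auto
  have ABC: "((\<lambda>x. (u'' x)\<^sup>2) has_integral A) ?I" "((\<lambda>x. (u' x)\<^sup>2) has_integral B) ?I"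
    "((\<lambda>x. (u x)\<^sup>2) has_integral C) ?I"
    unfolding A_def B_def C_def
    by (auto intro!: integrable_integral integrable_continuous_interval continuous_intros c)
  have W: "((\<lambda>x. well (cut (x / e)) * (u x)\<^sup>2) has_integral W) ?I"
    unfolding W_def using e well_cut_outside(1)
    by (intro integral_supported continuous_intros continuous_on_cut_scaled continuous_on_subset[OF c(1) sub]) auto
  have "((\<lambda>x. (u'' x)\<^sup>2 - (u' x)\<^sup>2 + (19 * (u x)\<^sup>2 + (1 / (44 * e^4)) * (well (cut (x / e)) * (u x)\<^sup>2)))
      has_integral (A - B + (19 * C + (1 / (44 * e^4)) * W))) ?I"
    by (intro has_integral_add has_integral_diff has_integral_mult_right ABC W)
  then have lhs: "integral ?I (\<lambda>x. (u'' x)\<^sup>2 - (u' x)\<^sup>2 + flow_x e x * (u x)\<^sup>2)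
      = A - B + 19 * C + W / (44 * e^4)"
    by (intro integral_unique) (simp add: flow_x_def algebra_simps)
  have rhs: "integral ?I (\<lambda>x. (u'' x)\<^sup>2 + (u x)\<^sup>2) = A + C"
    by (intro integral_unique has_integral_add ABC)
  have "W = integral {-e..e} (\<lambda>x. well (x / e) * (u x)\<^sup>2)"
    unfolding W_def by (intro integral_cong) (use e cut_scaled(3) in auto)
  also have "\<dots> \<ge> - 22 * e^4 * integral {-e..e} (\<lambda>x. (u'' x)\<^sup>2)"
    using e by (intro well_form_bound[OF C2_on_subset[OF u(1)] u(2)]) auto
  finally have "W \<ge> - 22 * e^4 * integral {-e..e} (\<lambda>x. (u'' x)\<^sup>2)" .
  moreover have "integral {-e..e} (\<lambda>x. (u'' x)\<^sup>2) \<le> A"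
    unfolding A_def
    by (intro integral_subset_le sub integrable_continuous_interval continuous_intros
        continuous_on_subset[OF c(3) sub] c) auto
  then have "22 * e^4 * integral {-e..e} (\<lambda>x. (u'' x)\<^sup>2) \<le> 22 * e^4 * A"
    using e by (intro mult_left_mono) auto
  ultimately have "W \<ge> - 22 * e^4 * A"
    by simp
  then have "- A / 2 * (44 * e^4) \<le> W"
    by (simp add: mult_ac)
  moreover define V where "V = W / (44 * e^4)"
  ultimately have "V \<ge> - A / 2"
    using e by (simp only: V_def pos_le_divide_eq mult_pos_pos zero_less_power zero_less_numeral)
  moreover have "6 * B \<le> A + 108 * C"
    using interpolation[OF L u(1)] by (simp add: A_def B_def C_def)
  moreover have "A \<ge> 0" "C \<ge> 0"
    using ABC(1,3) by (auto intro: has_integral_nonneg)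
  ultimately show ?thesis
    unfolding lhs rhs V_def[symmetric] by (simp add: field_simps)
qed

lemma flow_bound:
  assumes "0 < e" "e^3 = 4 / 21945 / L" "L > 0" "\<bar>x\<bar> \<le> L"
  shows "\<bar>flow e x\<bar> \<le> 900 * L"
proof -
  have "\<bar>flow e x\<bar> \<le> \<bar>19 * x\<bar> + \<bar>well_prim (cut (x / e)) / (44 * e^3)\<bar>"
    unfolding flow_def by (rule abs_triangle_ineq)
  also have "\<bar>well_prim (cut (x / e)) / (44 * e^3)\<bar> = \<bar>well_prim (cut (x / e))\<bar> / (44 * e^3)"
    using assms(1) by (simp add: abs_divide)
  also have "\<dots> \<le> 7 / (44 * e^3)"
    using assms(1) by (intro divide_right_mono abs_well_prim_le abs_cut_le) auto
  also have "\<dots> = 153615 / 176 * L"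
    using assms by simp
  finally show ?thesis
    using assms by linarith
qed

lemma integral_flow_x_squared:
  assumes "0 < e" "e \<le> L"
  shows "integral {-L..L} (\<lambda>x. (flow_x e x)\<^sup>2) \<le> 1444 * L + 4 / e^7"
proof -
  define h where "h x = well (cut (x / e)) / (44 * e^4)" for x
  have ch: "continuous_on S h" for S
    unfolding h_def [abs_def] using assms by (intro continuous_intros continuous_on_cut_scaled) auto
  have hb: "(h x)\<^sup>2 \<le> 1 / e^8" for x
  proof -
    have "\<bar>h x\<bar> \<le> 1 / (44 * e^4)"
      unfolding h_def abs_divide using assms abs_well_le[OF abs_cut_le]
      by (simp add: divide_right_mono)
    also have "\<dots> \<le> 1 / e^4"
      using assms by (simp add: divide_simps)
    finally have "\<bar>h x\<bar>\<^sup>2 \<le> (1 / e^4)\<^sup>2"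
      by (intro power_mono) auto
    then show ?thesis
      by (simp add: power_divide flip: power_mult)
  qed
  have "integral {-L..L} (\<lambda>x. (h x)\<^sup>2) \<le> 2 * e * (1 / e^8)"
    using assms hb well_cut_outside(1)
    by (intro integral_supported_le continuous_intros ch) (auto simp: h_def)
  also have "2 * e * (1 / e^8) = 2 / e^7"
    using assms by (simp add: power_numeral_reduce)
  finally have h2: "integral {-L..L} (\<lambda>x. (h x)\<^sup>2) \<le> 2 / e^7" .
  have "integral {-L..L} (\<lambda>x. (flow_x e x)\<^sup>2) \<le> integral {-L..L} (\<lambda>x. 722 + 2 * (h x)\<^sup>2)"
  proof (intro integral_le integrable_continuous_interval continuous_intros continuous_on_flow_x ch assms)
    fix x
    \<comment> \<open>The square of a sum is at most twice the sum of the squares, and \<open>722 = 2 * 19\<^sup>2\<close>.\<close>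
    have "flow_x e x = 19 + h x"
      by (simp add: flow_x_def h_def)
    then show "(flow_x e x)\<^sup>2 \<le> 722 + 2 * (h x)\<^sup>2"
      using zero_le_power2[of "19 - h x"] by (simp add: power2_eq_square algebra_simps)
  qed
  also have "\<dots> = 1444 * L + 2 * integral {-L..L} (\<lambda>x. (h x)\<^sup>2)"
    using assms
    by (subst Henstock_Kurzweil_Integration.integral_add)
       (auto intro!: integrable_continuous_interval continuous_intros ch)
  also have "\<dots> \<le> 1444 * L + 2 * (2 / e^7)"
    using h2 by (intro add_left_mono mult_left_mono) auto
  finally show ?thesis
    by simp
qed

lemma integral_flow_xx_squared:
  assumes "0 < e" "e \<le> L"
  shows "integral {-L..L} (\<lambda>x. (flow_xx e x)\<^sup>2) \<le> 8 / e^9"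
proof -
  have "(flow_xx e x)\<^sup>2 \<le> 4 / e^10" for x
  proof -
    have "\<bar>flow_xx e x\<bar> = \<bar>well_deriv (cut (x / e))\<bar> / (44 * e^5)"
      unfolding flow_xx_def abs_divide using assms by simp
    also have "\<dots> \<le> 88 / (44 * e^5)"
      using assms by (intro divide_right_mono abs_well_deriv_le abs_cut_le) auto
    finally have "\<bar>flow_xx e x\<bar> \<le> 2 / e^5"
      by simp
    then have "\<bar>flow_xx e x\<bar>\<^sup>2 \<le> (2 / e^5)\<^sup>2"
      by (intro power_mono) auto
    then show ?thesis
      by (simp add: power_divide flip: power_mult)
  qed
  then have "integral {-L..L} (\<lambda>x. (flow_xx e x)\<^sup>2) \<le> 2 * e * (4 / e^10)"
    using assms well_cut_outside(2)
    by (intro integral_supported_le continuous_intros continuous_on_flow_xx) (auto simp: flow_xx_def)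
  also have "2 * e * (4 / e^10) = 8 / e^9"
    using assms by (simp add: power_numeral_reduce)
  finally show ?thesis .
qed

lemma wrap_eq_on_period:
  assumes "0 < e" "e < L" and match: "\<And>x. e < x \<Longrightarrow> x < 2 * L - e \<Longrightarrow> g x = g (x - 2 * L)"
    and x: "x \<in> {-L..L}"
  shows "g (wrap L x) = g x"
proof (cases "x = L")
  case True
  then have "wrap L x = x - 2 * L"
    using wrap_eqI[of L x 1] assms by simp
  then show ?thesis
    using match[of x] True assms by simp
next
  case False
  then show ?thesis
    using wrap_eqI[of L x 0] assms by simp
qed

theorem theorem1:
  shows "\<exists>c>0. \<exists>L\<^sub>0>0. \<forall>L\<ge>L\<^sub>0. \<exists>\<phi> \<phi>\<^sub>x \<phi>\<^sub>x\<^sub>x :: real \<Rightarrow> real.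
    H2_per L \<phi> \<phi>\<^sub>x \<phi>\<^sub>x\<^sub>x \<and>
    periodic_fun_simple \<phi>\<^sub>x (2 * L) \<and> (LINT x:{-L..L}|lebesgue. \<phi>\<^sub>x x) = 0 \<and>
    (\<forall>u u\<^sub>x u\<^sub>x\<^sub>x :: real \<Rightarrow> real. C2_on (-L) L u u\<^sub>x u\<^sub>x\<^sub>x \<and> u 0 = 0 \<longrightarrow>
       (LINT x:{-L..L}|lebesgue. (u\<^sub>x\<^sub>x x)\<^sup>2 - (u\<^sub>x x)\<^sup>2 + \<phi>\<^sub>x x * (u x)\<^sup>2)
         \<ge> 1/4 * (LINT x:{-L..L}|lebesgue. (u\<^sub>x\<^sub>x x)\<^sup>2 + (u x)\<^sup>2)) \<and>
    H2_norm L \<phi> \<phi>\<^sub>x \<phi>\<^sub>x\<^sub>x \<le> c * L powr (3/2)"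
proof -
  define \<kappa> :: real where "\<kappa> = 4 / 21945"
  \<comment> \<open>The contributions of \<open>\<phi>\<close>, of the constant 19 in \<open>\<phi>\<^sub>x\<close>, and of the well in
      \<open>\<phi>\<^sub>x\<close> and \<open>\<phi>\<^sub>x\<^sub>x\<close> to the squared norm, each divided by \<open>L\<^sup>3\<close>.\<close>
  define K where "K = 1620000 + 1444 + 12 / \<kappa>^3"
  have K: "K > 0"
    unfolding K_def \<kappa>_def by (intro add_pos_pos divide_pos_pos zero_less_power) auto
  have main: "\<exists>\<phi> \<phi>\<^sub>x \<phi>\<^sub>x\<^sub>x :: real \<Rightarrow> real.
    H2_per L \<phi> \<phi>\<^sub>x \<phi>\<^sub>x\<^sub>x \<and>
    periodic_fun_simple \<phi>\<^sub>x (2 * L) \<and> (LINT x:{-L..L}|lebesgue. \<phi>\<^sub>x x) = 0 \<and>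
    (\<forall>u u\<^sub>x u\<^sub>x\<^sub>x :: real \<Rightarrow> real. C2_on (-L) L u u\<^sub>x u\<^sub>x\<^sub>x \<and> u 0 = 0 \<longrightarrow>
       (LINT x:{-L..L}|lebesgue. (u\<^sub>x\<^sub>x x)\<^sup>2 - (u\<^sub>x x)\<^sup>2 + \<phi>\<^sub>x x * (u x)\<^sup>2)
         \<ge> 1/4 * (LINT x:{-L..L}|lebesgue. (u\<^sub>x\<^sub>x x)\<^sup>2 + (u x)\<^sup>2)) \<and>
    H2_norm L \<phi> \<phi>\<^sub>x \<phi>\<^sub>x\<^sub>x \<le> sqrt K * L powr (3/2)" if L: "L \<ge> 1" for L
  proof -
    define e where "e = root 3 (\<kappa> / L)"
    have e3: "e^3 = \<kappa> / L" and e0: "e > 0"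
      using L by (auto simp: e_def \<kappa>_def)
    have e1: "e < 1"
    proof -
      have "\<kappa> / L < 1"
        using L by (simp add: \<kappa>_def divide_simps)
      then show ?thesis
        unfolding e_def by (simp add: real_root_lt_1_iff)
    qed
    then have eL: "e < L" "e \<le> L"
      using L by auto
    have L0: "L > 0"
      using L by simp
    note match = flow_matches[OF e0 _ _ e3[unfolded \<kappa>_def] L0]
    define \<phi> \<phi>\<^sub>x \<phi>\<^sub>x\<^sub>x where "\<phi> x = flow e (wrap L x)" and "\<phi>\<^sub>x x = flow_x e (wrap L x)"
      and "\<phi>\<^sub>x\<^sub>x x = flow_xx e (wrap L x)" for x
    have per: "periodic_fun_simple \<phi> (2 * L)" "periodic_fun_simple \<phi>\<^sub>x (2 * L)"
      unfolding \<phi>_def [abs_def] \<phi>\<^sub>x_def [abs_def] by (rule wrap_periodic[OF L0])+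
    have d: "(\<phi> has_real_derivative \<phi>\<^sub>x x) (at x)" "(\<phi>\<^sub>x has_real_derivative \<phi>\<^sub>x\<^sub>x x) (at x)" for x
      unfolding \<phi>_def [abs_def] \<phi>\<^sub>x_def [abs_def] \<phi>\<^sub>x\<^sub>x_def [abs_def]
      using wrap_has_derivative[OF e0 eL(1) match(1) DERIV_flow[OF e0]]
        wrap_has_derivative[OF e0 eL(1) match(2) DERIV_flow_x[OF e0]] by auto
    have c: "continuous_on S \<phi>" "continuous_on S \<phi>\<^sub>x" for S
      using d by (meson DERIV_isCont continuous_at_imp_continuous_on)+
    have "continuous_on UNIV \<phi>\<^sub>x\<^sub>x"
      unfolding \<phi>\<^sub>x\<^sub>x_def [abs_def]
      by (rule wrap_continuous[OF e0 eL(1) match(3) continuous_on_flow_xx[OF e0]])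
    then have c2: "continuous_on S \<phi>\<^sub>x\<^sub>x" for S
      using continuous_on_subset by blast
    have on: "\<phi>\<^sub>x x = flow_x e x" "\<phi>\<^sub>x\<^sub>x x = flow_xx e x" if "x \<in> {-L..L}" for x
      unfolding \<phi>\<^sub>x_def \<phi>\<^sub>x\<^sub>x_def
      using wrap_eq_on_period[where g = "flow_x e", OF e0 eL(1) match(2) that]
        wrap_eq_on_period[where g = "flow_xx e", OF e0 eL(1) match(3) that] by auto
    have "H2_per L \<phi> \<phi>\<^sub>x \<phi>\<^sub>x\<^sub>x"
      unfolding H2_per_def
      using per DERIV_imp_weak_derivative[OF d(1)] DERIV_imp_weak_derivative[OF d(2)] c c2
        square_integrable_on_continuous by blast
    moreover have "(LINT x:{-L..L}|lebesgue. \<phi>\<^sub>x x) = 0"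
    proof -
      have "(\<phi>\<^sub>x has_integral (\<phi> L - \<phi> (-L))) {-L..L}"
        using L d(1)
        by (intro fundamental_theorem_of_calculus)
           (auto simp: has_real_derivative_iff_has_vector_derivative has_vector_derivative_at_within)
      moreover have "\<phi> L = \<phi> (-L)"
        using periodic_fun_simple.plus_period[OF per(1), of "-L"] by simp
      ultimately show ?thesis
        using LINT_continuous_eq_integral[OF c(2)] by (simp add: integral_unique)
    qed
    moreover have "(LINT x:{-L..L}|lebesgue. (u\<^sub>x\<^sub>x x)\<^sup>2 - (u\<^sub>x x)\<^sup>2 + \<phi>\<^sub>x x * (u x)\<^sup>2)
         \<ge> 1/4 * (LINT x:{-L..L}|lebesgue. (u\<^sub>x\<^sub>x x)\<^sup>2 + (u x)\<^sup>2)"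
      if u: "C2_on (-L) L u u\<^sub>x u\<^sub>x\<^sub>x" "u 0 = 0" for u u\<^sub>x u\<^sub>x\<^sub>x
    proof -
      have cu: "continuous_on {-L..L} u" "continuous_on {-L..L} u\<^sub>x" "continuous_on {-L..L} u\<^sub>x\<^sub>x"
        using C2_on_continuous[OF u(1)] by auto
      have "(LINT x:{-L..L}|lebesgue. (u\<^sub>x\<^sub>x x)\<^sup>2 - (u\<^sub>x x)\<^sup>2 + \<phi>\<^sub>x x * (u x)\<^sup>2)
          = integral {-L..L} (\<lambda>x. (u\<^sub>x\<^sub>x x)\<^sup>2 - (u\<^sub>x x)\<^sup>2 + \<phi>\<^sub>x x * (u x)\<^sup>2)"
        by (intro LINT_continuous_eq_integral continuous_intros cu c)
      also have "\<dots> = integral {-L..L} (\<lambda>x. (u\<^sub>x\<^sub>x x)\<^sup>2 - (u\<^sub>x x)\<^sup>2 + flow_x e x * (u x)\<^sup>2)"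
        by (intro integral_cong) (simp add: on)
      also have "\<dots> \<ge> 1/4 * integral {-L..L} (\<lambda>x. (u\<^sub>x\<^sub>x x)\<^sup>2 + (u x)\<^sup>2)"
        by (rule flow_x_coercive[OF e0 eL(2) L u])
      also have "integral {-L..L} (\<lambda>x. (u\<^sub>x\<^sub>x x)\<^sup>2 + (u x)\<^sup>2) = (LINT x:{-L..L}|lebesgue. (u\<^sub>x\<^sub>x x)\<^sup>2 + (u x)\<^sup>2)"
        by (intro LINT_continuous_eq_integral[symmetric] continuous_intros cu)
      finally show ?thesis .
    qed
    moreover have "H2_norm L \<phi> \<phi>\<^sub>x \<phi>\<^sub>x\<^sub>x \<le> sqrt K * L powr (3/2)"
    proof -
      have e9: "1 / e^9 = L^3 / \<kappa>^3"
      proof -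
        have "e^9 = (e^3)^3"
          by (simp flip: power_mult)
        then show ?thesis
          by (simp add: e3 power_divide)
      qed
      have "4 / e^7 \<le> 4 / e^9"
        using e0 e1 by (intro divide_left_mono power_decreasing mult_pos_pos zero_less_power) auto
      moreover have "integral {-L..L} (\<lambda>x. (\<phi> x)\<^sup>2) \<le> integral {-L..L} (\<lambda>_. (900 * L)\<^sup>2)"
      proof (intro integral_le integrable_continuous_interval continuous_intros c)
        fix x
        have "\<bar>\<phi> x\<bar> \<le> 900 * L"
          unfolding \<phi>_def using wrap_bounds[OF L0, of x]
          by (intro flow_bound[OF e0 e3[unfolded \<kappa>_def] L0]) auto
        then have "\<bar>\<phi> x\<bar>\<^sup>2 \<le> (900 * L)\<^sup>2"
          by (intro power_mono) auto
        then show "(\<phi> x)\<^sup>2 \<le> (900 * L)\<^sup>2"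
          by simp
      qed
      moreover have "integral {-L..L} (\<lambda>_. (900 * L)\<^sup>2) = 1620000 * L^3"
        using L by (simp add: power2_eq_square power3_eq_cube)
      moreover have "integral {-L..L} (\<lambda>x. (\<phi>\<^sub>x x)\<^sup>2) \<le> 1444 * L + 4 / e^7"
        using integral_flow_x_squared[OF e0 eL(2)]
          integral_cong[of "{-L..L}" "\<lambda>x. (\<phi>\<^sub>x x)\<^sup>2" "\<lambda>x. (flow_x e x)\<^sup>2"] on(1)
        by simp
      moreover have "integral {-L..L} (\<lambda>x. (\<phi>\<^sub>x\<^sub>x x)\<^sup>2) \<le> 8 / e^9"
        using integral_flow_xx_squared[OF e0 eL(2)]
          integral_cong[of "{-L..L}" "\<lambda>x. (\<phi>\<^sub>x\<^sub>x x)\<^sup>2" "\<lambda>x. (flow_xx e x)\<^sup>2"] on(2)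
        by simp
      moreover have "L \<le> L^3"
        using L power_increasing[of 1 3 L] by simp
      moreover have "K * L^3 = 1620000 * L^3 + 1444 * L^3 + 12 * (1 / e^9)"
        unfolding K_def e9 by (simp add: algebra_simps)
      ultimately have "integral {-L..L} (\<lambda>x. (\<phi> x)\<^sup>2) + integral {-L..L} (\<lambda>x. (\<phi>\<^sub>x x)\<^sup>2)
          + integral {-L..L} (\<lambda>x. (\<phi>\<^sub>x\<^sub>x x)\<^sup>2) \<le> K * L^3"
        by linarith
      moreover have "H2_norm L \<phi> \<phi>\<^sub>x \<phi>\<^sub>x\<^sub>x = sqrt (integral {-L..L} (\<lambda>x. (\<phi> x)\<^sup>2)
          + integral {-L..L} (\<lambda>x. (\<phi>\<^sub>x x)\<^sup>2) + integral {-L..L} (\<lambda>x. (\<phi>\<^sub>x\<^sub>x x)\<^sup>2))"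
        unfolding H2_norm_def by (subst LINT_continuous_eq_integral, intro continuous_intros c c2)+ simp
      moreover have "sqrt (L^3) = L powr (3/2)"
        using L0 by (simp add: powr_half_sqrt[symmetric] powr_powr flip: powr_numeral)
      ultimately show ?thesis
        by (metis real_sqrt_le_mono real_sqrt_mult)
    qed
    ultimately show ?thesis
      using per(2) by blast
  qed
  show ?thesis
    using K main by (intro exI[of _ "sqrt K"] conjI exI[of _ "1::real"]) auto
qed

end
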